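(* Let $(X_t)$ be a stationary process with marginal distribution $P^0$, let $\{P_\theta:\theta\in\Theta\}$ be an arbitrary statistical model, and let $\hat\theta_n$ be the MMD estimator based on $X_1,\dots,X_n$. Then $$\mathbb{E}\left[\mathbb{D}_k\left(P_{\hat\theta_n},P^0\right)\right]\le \inf_{\theta\in\Theta}\mathbb{D}_k\left(P_\theta,P^0\right)+2\sqrt{\frac{1+2\sum_{t=1}^n\varrho_t}{n}}.$$
   Context: $(\mathbb{X},\mathcal{X})$ is a measurable space and $(X_t)$ is a (strictly) stationary $\mathbb{X}$-valued process; $P^0$ is the common distribution of the $X_t$. The model $\{P_\theta:\theta\in\Theta\}$ is a family of probability measures on $\mathbb{X}$ indexed by a set $\Theta$; it need not contain $P^0$. $k:\mathbb{X}\times\mathbb{X}\to\mathbb{R}$ is a symmetric positive definite (measurable) kernel with $|k(x,y)|\le 1$ for all $x,y$, with reproducing kernel Hilbert space $\mathcal{H}_k$. For a probability measure $P$ on $\mathbb{X}$, its mean embedding is $\mu_P=\mathbb{E}_{X\sim P}[k(X,\cdot)]\in\mathcal{H}_k$. The kernel is assumed characteristic, i.e. $P\mapsto\mu_P$ is injective. The maximum mean discrepancy (MMD) is $\mathbb{D}_k(P,Q)=\|\mu_P-\mu_Q\|_{\mathcal{H}_k}$. The empirical measure is $\hat P_n=\frac1n\sum_{i=1}^n\delta_{X_i}$. The MMD estimator $\hat\theta_n$ is a minimizer (assumed to exist): $\mathbb{D}_k(P_{\hat\theta_n},\hat P_n)=\inf_{\theta\in\Theta}\mathbb{D}_k(P_\theta,\hat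 P_n)$. The dependence coefficients are $\varrho_t=\left|\mathbb{E}\left\langle k(X_t,\cdot)-\mu_{P^0},\,k(X_0,\cdot)-\mu_{P^0}\right\rangle_{\mathcal{H}_k}\right|$, $t\in\mathbb{N}$. *)

theory Defs
  imports "HOL-Probability.Probability"
begin

definition psd_kernel :: "'a measure \<Rightarrow> ('a \<Rightarrow> 'a \<Rightarrow> real) \<Rightarrow> bool" where
  "psd_kernel N k \<longleftrightarrow>
     (\<lambda>(x, y). k x y) \<in> borel_measurable (N \<Otimes>\<^sub>M N) \<and>
     (\<forall>x\<in>space N. \<forall>y\<in>space N. k x y = k y x) \<and>
     (\<forall>S c. finite S \<and> S \<subseteq> space N \<longrightarrow> (\<Sum>x\<in>S. \<Sum>y\<in>S. c x * c y * k x y) \<ge> 0)"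

text \<open>
  The reproducing kernel Hilbert space of \<open>k\<close> on \<open>S\<close>: the elements of the Hilbert space \<open>'h\<close>
  are functions on \<open>S\<close>, where \<open>evl f x\<close> is the value of \<open>f\<close> at \<open>x\<close> and two elements with the
  same values on \<open>S\<close> are equal. It contains every section \<open>k(x, \<cdot>)\<close>, which is the element
  \<open>\<Phi> x\<close>, and has the reproducing property. By the Moore-Aronszajn theorem, these conditions
  determine the Hilbert space of functions uniquely.
\<close>
definition is_rkhs ::
    "'a set \<Rightarrow> ('a \<Rightarrow> 'a \<Rightarrow> real) \<Rightarrow> ('h::{real_inner,complete_space} \<Rightarrow> 'a \<Rightarrow> real) \<Rightarrow>
     ('a \<Rightarrow> 'h) \<Rightarrow> bool" where
  "is_rkhs S k evl \<Phi> \<longleftrightarrow>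
     (\<forall>x\<in>S. linear (\<lambda>f. evl f x)) \<and>
     (\<forall>f g. (\<forall>x\<in>S. evl f x = evl g x) \<longrightarrow> f = g) \<and>
     (\<forall>x\<in>S. \<forall>y\<in>S. evl (\<Phi> x) y = k x y) \<and>
     (\<forall>f. \<forall>x\<in>S. evl f x = inner f (\<Phi> x))"

text \<open>
  The expectation of the random element \<open>\<Phi> X = k(X, \<cdot>)\<close> for \<open>X\<close> distributed as \<open>P\<close>. It is
  taken as a weak (Pettis) integral, because the Bochner integral of the library exists only for
  separable spaces, and the Hilbert space of a bounded measurable kernel need not be separable.
  For such a kernel \<open>\<lambda>f. \<integral>x. inner f (\<Phi> x) \<partial>P\<close> is a bounded functional, so by Riesz
  representation the described element exists.
\<close>
definition mean_embedding :: "('a \<Rightarrow> 'h::{real_inner,complete_space}) \<Rightarrow> 'a measure \<Rightarrow> 'h" where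
  "mean_embedding \<Phi> P = (THE m. \<forall>f. inner f m = (\<integral>x. inner f (\<Phi> x) \<partial>P))"

definition mmd ::
    "('a \<Rightarrow> 'h::{real_inner,complete_space}) \<Rightarrow> 'a measure \<Rightarrow> 'a measure \<Rightarrow> real" where
  "mmd \<Phi> P Q = norm (mean_embedding \<Phi> P - mean_embedding \<Phi> Q)"

definition prob_measures_on :: "'a measure \<Rightarrow> 'a measure set" where
  "prob_measures_on N = {P. prob_space P \<and> sets P = sets N}"

definition characteristic_kernel ::
    "'a measure \<Rightarrow> ('a \<Rightarrow> 'h::{real_inner,complete_space}) \<Rightarrow> bool" where
  "characteristic_kernel N \<Phi> \<longleftrightarrow> inj_on (mean_embedding \<Phi>) (prob_measures_on N)"

definition strictly_stationary ::
    "'w measure \<Rightarrow> 'a measure \<Rightarrow> (nat \<Rightarrow> 'w \<Rightarrow> 'a) \<Rightarrow> bool" where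
  "strictly_stationary M N X \<longleftrightarrow>
     (\<forall>t. X t \<in> measurable M N) \<and>
     (\<forall>J h. finite J \<longrightarrow>
        distr M (\<Pi>\<^sub>M t\<in>J. N) (\<lambda>\<omega>. \<lambda>t\<in>J. X (t + h) \<omega>) =
        distr M (\<Pi>\<^sub>M t\<in>J. N) (\<lambda>\<omega>. \<lambda>t\<in>J. X t \<omega>))"

text \<open>The Dirac measure at \<open>x\<close> is \<open>return N x\<close>; the sample points are \<open>x 1, \<dots>, x n\<close>.\<close>
definition empirical_measure :: "'a measure \<Rightarrow> nat \<Rightarrow> (nat \<Rightarrow> 'a) \<Rightarrow> 'a measure" where
  "empirical_measure N n x =
     measure_of (space N) (sets N)
       (\<lambda>A. ennreal (1 / real n) * (\<Sum>i=1..n. emeasure (return N (x i)) A))"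

definition mmd_estimator ::
    "'w measure \<Rightarrow> 'a measure \<Rightarrow> ('a \<Rightarrow> 'h::{real_inner,complete_space}) \<Rightarrow>
     't set \<Rightarrow> ('t \<Rightarrow> 'a measure) \<Rightarrow> (nat \<Rightarrow> 'w \<Rightarrow> 'a) \<Rightarrow> nat \<Rightarrow> ('w \<Rightarrow> 't) \<Rightarrow> bool" where
  "mmd_estimator M N \<Phi> \<Theta> P X n \<theta>hat \<longleftrightarrow>
     (\<forall>\<omega>\<in>space M. \<theta>hat \<omega> \<in> \<Theta> \<and>
        mmd \<Phi> (P (\<theta>hat \<omega>)) (empirical_measure N n (\<lambda>i. X i \<omega>)) =
        (INF \<theta>\<in>\<Theta>. mmd \<Phi> (P \<theta>) (empirical_measure N n (\<lambda>i. X i \<omega>))))"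

definition dep_coeff ::
    "'w measure \<Rightarrow> ('a \<Rightarrow> 'h::{real_inner,complete_space}) \<Rightarrow> 'a measure \<Rightarrow>
     (nat \<Rightarrow> 'w \<Rightarrow> 'a) \<Rightarrow> nat \<Rightarrow> real" where
  "dep_coeff M \<Phi> P0 X t =
     \<bar>\<integral>\<omega>. inner (\<Phi> (X t \<omega>) - mean_embedding \<Phi> P0)
                (\<Phi> (X 0 \<omega>) - mean_embedding \<Phi> P0) \<partial>M\<bar>"

end

theory Submission
  imports Defs
begin

text \<open>
  By the triangle inequality and the minimality of the estimator,
  \<open>mmd(P_\<theta>hat, P0) \<le> mmd(P_\<theta>, P0) + 2 mmd(P_n, P0)\<close> for every \<open>\<theta>\<close>, where \<open>P_n\<close> is the empirical
  measure, so only \<open>E mmd(P_n, P0)\<close> has to be bounded. By Jensen it is at most the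
  square root of \<open>E (norm (mean of (\<Phi> X_i - \<mu>)))^2\<close>; expanding the square and using
  stationarity, each row of the resulting double sum is at most 1 (the diagonal term)
  plus twice the sum of the dependence coefficients.

  No separability is assumed, so \<open>\<Phi>\<close> need not be Borel measurable. Every scalar function
  \<open>inner f (\<Phi> x)\<close> is nevertheless measurable, because the sections of the kernel span a dense
  subspace, and the mean embedding exists by Riesz representation.
\<close>

section \<open>Riesz representation and dense spans in a Hilbert space\<close>

text \<open>A minimising sequence of the energy \<open>J\<close> is Cauchy by the parallelogram law,
  and vanishing of the first variation at its limit is the claimed identity. The case
  \<open>V = UNIV\<close> yields mean embeddings, the case of a closed span yields orthogonal
  projections.\<close>

lemma riesz_closed_subspace:
  fixes V :: "'h::{real_inner,complete_space} set" and L :: "'h \<Rightarrow> real"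
  assumes V: "subspace V" "closed V" and L: "bounded_linear L"
  shows "\<exists>m\<in>V. \<forall>f\<in>V. inner f m = L f"
proof -
  interpret L: bounded_linear L by (rule L)
  \<comment> \<open>The representer is the minimiser of this strictly convex energy.\<close>
  define J where "J v = (norm v)\<^sup>2 - 2 * L v" for v
  obtain B where B: "\<And>x. norm (L x) \<le> norm x * B" using L.bounded by blast
  \<comment> \<open>Completing the square: \<open>J v\<close> is at least
    \<open>(norm v - B)\<^sup>2 - B\<^sup>2\<close>.\<close>
  have Jlow: "- B\<^sup>2 \<le> J v" for v
  proof -
    have "0 \<le> (norm v - B)\<^sup>2" by simp
    moreover have "L v \<le> norm v * B" using B[of v] by simp
    ultimately show ?thesis by (simp add: J_def power2_diff)
  qed
  have bdd: "bdd_below (J ` V)" using Jlow by (intro bdd_belowI2)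
  have ne: "V \<noteq> {}" using subspace_0[OF V(1)] by auto
  define d where "d = (INF v\<in>V. J v)"
  have d_le: "d \<le> J v" if "v \<in> V" for v
    unfolding d_def using bdd that by (rule cINF_lower)
  have "\<exists>v\<in>V. J v < d + 1 / Suc i" for i
    using cINF_less_iff[OF ne bdd, of "d + 1 / Suc i"] by (simp add: d_def)
  then obtain v where v: "\<And>i. v i \<in> V" "\<And>i. J (v i) < d + 1 / Suc i" by metis
  have dist_le: "(norm (x - y))\<^sup>2 \<le> 2 * (J x + J y - 2 * d)" if "x \<in> V" "y \<in> V" for x y
  proof -
    have "(1/2) *\<^sub>R (x + y) \<in> V" using V(1) that by (simp add: subspace_add subspace_scale)
    then have "d \<le> J ((1/2) *\<^sub>R (x + y))" by (rule d_le)
    \<comment> \<open>The parallelogram identity; the terms with \<open>L\<close> cancel because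
      \<open>L\<close> is linear.\<close>
    moreover have "(norm (x - y))\<^sup>2 = 2 * (J x + J y - 2 * J ((1/2) *\<^sub>R (x + y)))"
      by (simp add: J_def L.add L.scaleR power2_norm_eq_inner inner_simps inner_commute
          algebra_simps del: norm_scaleR)
    ultimately show ?thesis by simp
  qed
  have "Cauchy v"
  proof (rule metric_CauchyI)
    fix e :: real assume e: "e > 0"
    \<comment> \<open>Each energy then exceeds \<open>d\<close> by less than
      \<open>e\<^sup>2 / 4\<close>; the two excesses and the factor 2 in \<open>dist_le\<close> add
      up to \<open>e\<^sup>2\<close>.\<close>
    obtain K where K: "inverse (real (Suc K)) < e\<^sup>2 / 4"
      using reals_Archimedean[of "e\<^sup>2 / 4"] e by auto
    have "dist (v i) (v j) < e" if "i \<ge> K" "j \<ge> K" for i j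
    proof -
      have "1 / real (Suc i) \<le> 1 / real (Suc K)" "1 / real (Suc j) \<le> 1 / real (Suc K)"
        using that by (auto simp: frac_le)
      then have "J (v i) + J (v j) - 2 * d < e\<^sup>2 / 2"
        using v(2)[of i] v(2)[of j] K by (simp add: inverse_eq_divide)
      then have "(norm (v i - v j))\<^sup>2 < e\<^sup>2" using dist_le[OF v(1) v(1), of i j] by simp
      then show ?thesis using e by (simp add: dist_norm power2_less_imp_less)
    qed
    then show "\<exists>K. \<forall>i\<ge>K. \<forall>j\<ge>K. dist (v i) (v j) < e" by blast
  qed
  then obtain m where m: "v \<longlonglongrightarrow> m" using Cauchy_convergent convergent_def by blast
  have mV: "m \<in> V" using closed_sequentially[OF V(2) _ m] v(1) by blast
  have "(\<lambda>i. J (v i)) \<longlonglongrightarrow> J m" unfolding J_def by (intro tendsto_intros L.tendsto m)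
  moreover have "(\<lambda>i. d + 1 / real (Suc i)) \<longlonglongrightarrow> d + 0"
    using LIMSEQ_inverse_real_of_nat by (intro tendsto_intros) (simp add: inverse_eq_divide)
  ultimately have Jm: "J m \<le> d"
    using v(2) by (intro LIMSEQ_le[of "\<lambda>i. J (v i)" _ "\<lambda>i. d + 1 / real (Suc i)"])
      (auto intro: less_imp_le)
  have "inner f m = L f" if f: "f \<in> V" for f
  proof -
    \<comment> \<open>The variation of \<open>J\<close> along \<open>f\<close> is
      \<open>t\<^sup>2 * q + 2 * t * a\<close>. This \<open>t\<close> makes it negative unless
      \<open>a = 0\<close>; the \<open>+ 1\<close> keeps the denominator positive when
      \<open>f = 0\<close>.\<close>
    define a q t where "a = inner f m - L f" and "q = inner f f" and "t = - a / (q + 1)"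
    have q: "q \<ge> 0" by (simp add: q_def)
    have "m + t *\<^sub>R f \<in> V" using V(1) mV f by (simp add: subspace_add subspace_scale)
    then have "J m \<le> J (m + t *\<^sub>R f)" using Jm d_le by fastforce
    moreover have "(norm (m + t *\<^sub>R f))\<^sup>2 = (norm m)\<^sup>2 + 2 * t * inner f m + t\<^sup>2 * q"
      unfolding power2_norm_eq_inner q_def
      by (simp add: inner_simps inner_commute algebra_simps power2_eq_square)
    ultimately have "0 \<le> t\<^sup>2 * q + 2 * t * a"
      by (simp add: J_def L.add L.scaleR a_def algebra_simps)
    also have "\<dots> = - (a\<^sup>2 * (q + 2) / (q + 1)\<^sup>2)"
      unfolding t_def using q by (simp add: divide_simps power2_eq_square) (simp add: algebra_simps)
    finally have "a\<^sup>2 * ((q + 2) / (q + 1)\<^sup>2) \<le> 0" by simp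
    moreover have "(q + 2) / (q + 1)\<^sup>2 > 0" using q by simp
    ultimately have "a\<^sup>2 \<le> 0" unfolding mult_le_0_iff by linarith
    then have "a = 0" by simp
    then show ?thesis by (simp add: a_def)
  qed
  then show ?thesis using mV by blast
qed

lemma subspace_closure:
  fixes V :: "'h::real_normed_vector set"
  assumes "subspace V"
  shows "subspace (closure V)"
  unfolding subspace_def
proof (intro conjI ballI allI)
  show "0 \<in> closure V"
    using subspace_0[OF assms] closure_subset by blast
next
  fix a b assume "a \<in> closure V"
    and "b \<in> closure V"
  then obtain x y where "\<And>i. x i \<in> V" "\<And>i. y i \<in> V" "x \<longlonglongrightarrow> a" "y \<longlonglongrightarrow> b"
    unfolding closure_sequential by blast
  then show "a + b \<in> closure V"
    unfolding closure_sequential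
    by (auto intro!: exI[of _ "\<lambda>i. x i + y i"] tendsto_add subspace_add[OF assms])
next
  fix c :: real and a assume "a \<in> closure V"
  then obtain x where "\<And>i. x i \<in> V" "x \<longlonglongrightarrow> a"
    unfolding closure_sequential by blast
  then show "c *\<^sub>R a \<in> closure V"
    unfolding closure_sequential
    by (auto intro!: exI[of _ "\<lambda>i. c *\<^sub>R x i"] tendsto_scaleR subspace_scale[OF assms])
qed

text \<open>The element \<open>m\<close> representing \<open>inner g f\<close> on the closed span is
  the orthogonal projection of \<open>f\<close>. The residual \<open>f - m\<close> is orthogonal to
  \<open>A\<close>, hence zero.\<close>

lemma dense_span_of_total:
  fixes A :: "'h::{real_inner,complete_space} set"
  assumes "\<And>g. (\<And>a. a \<in> A \<Longrightarrow> inner g a = 0) \<Longrightarrow> g = 0"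
  shows "closure (span A) = UNIV"
proof -
  have "f \<in> closure (span A)" for f
  proof -
    have "bounded_linear (\<lambda>g. inner g f)" by (rule bounded_linear_inner_left)
    then obtain m where m: "m \<in> closure (span A)"
      "\<forall>g\<in>closure (span A). inner g m = inner g f"
      using riesz_closed_subspace[of "closure (span A)" "\<lambda>g. inner g f"]
      by (auto simp: closed_subspace subspace_closure subspace_span)
    have "inner (f - m) a = 0" if "a \<in> A" for a
    proof -
      have "a \<in> closure (span A)" using that closure_subset span_base by blast
      then show ?thesis using m(2) by (simp add: inner_commute[of "f - m"] inner_diff_right)
    qed
    then have "f - m = 0" by (rule assms)
    then show ?thesis using m(1) by simp
  qed
  then show ?thesis by auto
qed

section \<open>Integration against the empirical measure\<close>

text \<open>The empirical measure is the image of the uniform distribution on \<open>{1..n}\<close>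
  under \<open>x\<close>, so the integral transfers to a finite average.\<close>

lemma integral_empirical_measure:
  fixes f :: "'a \<Rightarrow> real"
  assumes x: "\<And>i. x i \<in> space N" and n: "n \<ge> 1"
    and f: "f \<in> borel_measurable N"
  shows "(\<integral>y. f y \<partial>empirical_measure N n x) = (\<Sum>i=1..n. f (x i)) / real n"
proof -
  let ?U = "measure_pmf (pmf_of_set {1..n})"
  have xm: "x \<in> measurable ?U N" using x by simp
  have ne: "{1..n} \<noteq> {}" using n by simp
  have "ennreal (1 / real n) * (\<Sum>i=1..n. emeasure (return N (x i)) A) =
      emeasure (distr ?U N x) A" if A: "A \<in> sets N" for A
  proof -
    have "emeasure (distr ?U N x) A = emeasure ?U (x -` A)"
      using A xm by (simp add: emeasure_distr)
    also have "\<dots> = ennreal (real (card ({1..n} \<inter> x -` A)) / real n)"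
      using ne by (simp add: emeasure_pmf_of_set)
    also have "\<dots> = ennreal (1 / real n) * ennreal (real (card ({1..n} \<inter> x -` A)))"
      by (subst ennreal_mult'[symmetric]) (auto)
    also have "ennreal (real (card ({1..n} \<inter> x -` A))) = (\<Sum>i=1..n. indicator A (x i))"
    proof -
      have "(\<Sum>i=1..n. indicator A (x i) :: ennreal) = (\<Sum>i=1..n. ennreal (indicator (x -` A) i))"
        by (intro sum.cong) (auto simp: indicator_def)
      also have "\<dots> = ennreal (\<Sum>i=1..n. indicator (x -` A) i)"
        by (rule sum_ennreal) auto
      also have "(\<Sum>i=1..n. indicator (x -` A) i :: real) = real (card ({1..n} \<inter> x -` A))"
        by (simp add: indicator_def sum.If_cases vimage_def)
      finally show ?thesis by simp
    qed
    finally show ?thesis using A by simp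
  qed
  then have "empirical_measure N n x =
      measure_of (space N) (sets N) (emeasure (distr ?U N x))"
    unfolding empirical_measure_def
    by (intro measure_of_eq) (auto simp: sets.space_closed sets.sigma_sets_eq)
  also have "\<dots> = distr ?U N x" using measure_of_of_measure[of "distr ?U N x"] by simp
  finally have eq: "empirical_measure N n x = distr ?U N x" .
  show ?thesis
    unfolding eq using ne f xm by (subst integral_distr) (auto simp: integral_pmf_of_set)
qed

section \<open>Features and mean embeddings of a bounded kernel\<close>

locale bounded_rkhs =
  fixes N :: "'a measure" and k :: "'a \<Rightarrow> 'a \<Rightarrow> real"
    and evl :: "'h::{real_inner,complete_space} \<Rightarrow> 'a \<Rightarrow> real" and \<Phi> :: "'a \<Rightarrow> 'h"
  assumes kernel: "psd_kernel N k"
    and kernel_bound: "\<And>x y. x \<in> space N \<Longrightarrow> y \<in> space N \<Longrightarrow> \<bar>k x y\<bar> \<le> 1"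
    and rkhs: "is_rkhs (space N) k evl \<Phi>"
begin

abbreviation \<mu> where "\<mu> \<equiv> mean_embedding \<Phi>"

lemma inner_feature: "x \<in> space N \<Longrightarrow> y \<in> space N \<Longrightarrow> inner (\<Phi> x) (\<Phi> y) = k x y"
  using rkhs unfolding is_rkhs_def by metis

lemma norm_feature_le: "x \<in> space N \<Longrightarrow> norm (\<Phi> x) \<le> 1"
  using kernel_bound[of x x] inner_feature[of x x] by (simp add: norm_eq_sqrt_inner)

lemma abs_inner_feature_le: "x \<in> space N \<Longrightarrow> \<bar>inner f (\<Phi> x)\<bar> \<le> norm f"
  using Cauchy_Schwarz_ineq2[of f "\<Phi> x"] mult_left_mono[OF norm_feature_le, of x "norm f"]
  by force

lemma measurable_kernel:
  assumes "f \<in> measurable L N" "g \<in> measurable L N"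
  shows "(\<lambda>x. k (f x) (g x)) \<in> borel_measurable L"
proof -
  have "(\<lambda>(x, y). k x y) \<in> borel_measurable (N \<Otimes>\<^sub>M N)"
    using kernel by (simp add: psd_kernel_def)
  from measurable_compose[OF measurable_Pair[OF assms] this] show ?thesis by simp
qed

lemma measurable_inner_feature: "(\<lambda>x. inner f (\<Phi> x)) \<in> borel_measurable N"
proof -
  have on_span: "(\<lambda>x. inner g (\<Phi> x)) \<in> borel_measurable N" if "g \<in> span (\<Phi> ` space N)" for g
    using that
  proof (induction rule: span_induct_alt)
    case base
    then show ?case by simp
  next
    case (step c g h)
    then obtain y where y: "y \<in> space N" "g = \<Phi> y" by auto
    have "(\<lambda>x. k y x) \<in> borel_measurable N"
      using y by (intro measurable_kernel) auto
    then have "(\<lambda>x. inner g (\<Phi> x)) \<in> borel_measurable N"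
      by (subst measurable_cong[where g = "k y"]) (auto simp: y inner_feature)
    then show ?case using step by (simp add: inner_add_left)
  qed
  \<comment> \<open>By the reproducing property, orthogonality to all features means that
    \<open>g\<close> vanishes at every point of the space, and elements are determined by their
    values.\<close>
  have "g = 0" if "\<And>a. a \<in> \<Phi> ` space N \<Longrightarrow> inner g a = 0" for g
  proof -
    have ev: "\<forall>f. \<forall>x\<in>space N. evl f x = inner f (\<Phi> x)"
      and inj: "\<And>f g. \<forall>x\<in>space N. evl f x = evl g x \<Longrightarrow> f = g"
      using rkhs unfolding is_rkhs_def by blast+
    show ?thesis by (rule inj) (use ev that in auto)
  qed
  then have "f \<in> closure (span (\<Phi> ` space N))" using dense_span_of_total by blast
  then obtain g where g: "\<And>i. g i \<in> span (\<Phi> ` space N)" "g \<longlonglongrightarrow> f"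
    unfolding closure_sequential by blast
  show ?thesis
    by (rule borel_measurable_LIMSEQ_real[where u = "\<lambda>i x. inner (g i) (\<Phi> x)"])
      (auto intro!: tendsto_intros g on_span)
qed

lemma integrable_inner_feature:
  assumes "prob_space Q" "sets Q = sets N"
  shows "integrable Q (\<lambda>x. inner f (\<Phi> x))"
proof -
  interpret prob_space Q by fact
  show ?thesis
  proof (rule integrable_const_bound[where B = "norm f"])
    show "AE x in Q. norm (inner f (\<Phi> x)) \<le> norm f"
      using abs_inner_feature_le sets_eq_imp_space_eq[OF assms(2)] by (intro AE_I2) auto
    show "(\<lambda>x. inner f (\<Phi> x)) \<in> borel_measurable Q"
      using measurable_inner_feature assms(2) by (simp cong: measurable_cong_sets)
  qed
qed

text \<open>Two candidates \<open>m\<close> and \<open>m'\<close> have the same inner products with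
  every \<open>f\<close>; testing with \<open>f = m' - m\<close> makes them equal, which justifies
  the \<open>THE\<close>.\<close>

lemma mean_embedding_eqI:
  assumes "\<And>f. inner f m = (\<integral>x. inner f (\<Phi> x) \<partial>Q)"
  shows "\<mu> Q = m"
  unfolding mean_embedding_def
proof (rule the_equality)
  show "m' = m" if "\<forall>f. inner f m' = (\<integral>x. inner f (\<Phi> x) \<partial>Q)" for m'
  proof -
    have "inner (m' - m) (m' - m) = 0"
      using that assms by (simp add: inner_diff_right)
    then show ?thesis by simp
  qed
qed (use assms in auto)

text \<open>Features have norm at most 1, so integration of \<open>inner f (\<Phi> x)\<close> is a
  functional of \<open>f\<close> with bound 1, and Riesz supplies the representer.\<close>

lemma inner_mean_embedding:
  assumes "prob_space Q" "sets Q = sets N"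
  shows "inner f (\<mu> Q) = (\<integral>x. inner f (\<Phi> x) \<partial>Q)"
proof -
  interpret prob_space Q by fact
  note int = integrable_inner_feature[OF assms]
  let ?L = "\<lambda>f. \<integral>x. inner f (\<Phi> x) \<partial>Q"
  have "bounded_linear ?L"
  proof (rule bounded_linear_intro[where K = 1])
    fix f
    have "\<bar>?L f\<bar> \<le> (\<integral>x. \<bar>inner f (\<Phi> x)\<bar> \<partial>Q)" by (rule integral_abs_bound)
    also have "\<dots> \<le> (\<integral>x. norm f \<partial>Q)"
      using int abs_inner_feature_le sets_eq_imp_space_eq[OF assms(2)]
      by (intro integral_mono) auto
    finally show "norm (?L f) \<le> norm f * 1" by (simp add: prob_space)
  qed (use int in \<open>simp_all add: inner_add_left\<close>)
  then obtain m where m: "\<And>f. inner f m = ?L f"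
    using riesz_closed_subspace[of UNIV ?L] by auto
  show ?thesis using mean_embedding_eqI[OF m] m by simp
qed

text \<open>Testing the defining identity with \<open>\<mu> Q\<close> itself bounds its squared norm
  by its norm.\<close>

lemma norm_mean_embedding_le:
  assumes "prob_space Q" "sets Q = sets N"
  shows "norm (\<mu> Q) \<le> 1"
proof -
  interpret prob_space Q by fact
  have "(norm (\<mu> Q))\<^sup>2 = (\<integral>x. inner (\<mu> Q) (\<Phi> x) \<partial>Q)"
    by (simp add: power2_norm_eq_inner inner_mean_embedding[OF assms])
  also have "\<dots> \<le> (\<integral>x. norm (\<mu> Q) \<partial>Q)"
    using integrable_inner_feature[OF assms] abs_inner_feature_le sets_eq_imp_space_eq[OF assms(2)]
    by (intro integral_mono) (auto simp: abs_le_iff)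
  finally have "norm (\<mu> Q) * norm (\<mu> Q) \<le> 1 * norm (\<mu> Q)"
    by (simp add: prob_space power2_eq_square)
  then show ?thesis by (cases "\<mu> Q = 0") simp_all
qed

text \<open>The average of the features satisfies the weak defining identity. This turns the MMD to
  the empirical measure into the norm of an explicit vector.\<close>

lemma mean_embedding_empirical:
  assumes "\<And>i. x i \<in> space N" "n \<ge> 1"
  shows "\<mu> (empirical_measure N n x) = (1 / real n) *\<^sub>R (\<Sum>i=1..n. \<Phi> (x i))"
  by (rule mean_embedding_eqI)
    (simp add: integral_empirical_measure[OF assms measurable_inner_feature] inner_sum_right)

lemma inner_centred:
  "x \<in> space N \<Longrightarrow> y \<in> space N \<Longrightarrow>
    inner (\<Phi> x - m) (\<Phi> y - m) = k x y - inner m (\<Phi> x) - inner m (\<Phi> y) + inner m m"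
  by (simp add: inner_diff_left inner_diff_right inner_feature inner_commute)

text \<open>Both arguments vary and \<open>\<Phi>\<close> need not be measurable, so the product is
  expanded into the jointly measurable kernel and scalar functions of one feature each.\<close>

lemma measurable_inner_centred:
  assumes f: "f \<in> measurable L N" and g: "g \<in> measurable L N"
  shows "(\<lambda>x. inner (\<Phi> (f x) - m) (\<Phi> (g x) - m)) \<in> borel_measurable L"
proof -
  have "(\<lambda>x. k (f x) (g x) - inner m (\<Phi> (f x)) - inner m (\<Phi> (g x)) + inner m m)
      \<in> borel_measurable L"
    using measurable_kernel[OF f g] measurable_compose[OF f measurable_inner_feature]
      measurable_compose[OF g measurable_inner_feature] by simp
  then show ?thesis
    by (subst measurable_cong)
      (rule inner_centred[OF measurable_space[OF f] measurable_space[OF g]])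
qed

end

section \<open>Covariances of the features along the stationary process\<close>

locale stationary_features = bounded_rkhs N k evl \<Phi> + prob_space M
  for N :: "'a measure" and k
    and evl :: "'h::{real_inner,complete_space} \<Rightarrow> 'a \<Rightarrow> real" and \<Phi>
    and M :: "'w measure" +
  fixes X :: "nat \<Rightarrow> 'w \<Rightarrow> 'a" and P0 :: "'a measure"
  assumes stationary: "strictly_stationary M N X"
    and marginal: "\<And>t. distr M N (X t) = P0"
begin

lemma measurable_X: "X t \<in> measurable M N"
  using stationary by (simp add: strictly_stationary_def)

lemma X_space: "\<omega> \<in> space M \<Longrightarrow> X t \<omega> \<in> space N"
  using measurable_X by (rule measurable_space)

lemma prob_P0: "prob_space P0"
  using prob_space_distr[OF measurable_X, of 0] marginal by simp

lemma sets_P0: "sets P0 = sets N"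
  using marginal[of 0] by auto

text \<open>The scalar covariance of two centred features; the absolute value of
  \<open>cov t 0\<close> is the dependence coefficient at lag \<open>t\<close>.\<close>

definition cov where
  "cov i j = (\<integral>\<omega>. inner (\<Phi> (X i \<omega>) - \<mu> P0) (\<Phi> (X j \<omega>) - \<mu> P0) \<partial>M)"

lemma integrable_centred:
  "integrable M (\<lambda>\<omega>. inner (\<Phi> (X i \<omega>) - \<mu> P0) (\<Phi> (X j \<omega>) - \<mu> P0))"
\<comment> \<open>Feature and mean embedding each have norm at most 1, so centred features have norm
  at most 2 and their products are at most 4.\<close>
proof (rule integrable_const_bound[where B = 4])
  have "\<bar>inner (\<Phi> x - \<mu> P0) (\<Phi> y - \<mu> P0)\<bar> \<le> 2 * 2" if "x \<in> space N" "y \<in> space N" for x y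
  proof -
    have "norm (\<Phi> z - \<mu> P0) \<le> 2" if "z \<in> space N" for z
      using norm_triangle_ineq4[of "\<Phi> z" "\<mu> P0"] norm_feature_le[OF that]
        norm_mean_embedding_le[OF prob_P0 sets_P0] by simp
    then have "norm (\<Phi> x - \<mu> P0) * norm (\<Phi> y - \<mu> P0) \<le> 2 * 2"
      using that by (intro mult_mono) auto
    then show ?thesis using Cauchy_Schwarz_ineq2 order_trans by blast
  qed
  then show "AE \<omega> in M. norm (inner (\<Phi> (X i \<omega>) - \<mu> P0) (\<Phi> (X j \<omega>) - \<mu> P0)) \<le> 4"
    using X_space by (intro AE_I2) auto
qed (intro measurable_inner_centred measurable_X)

lemma cov_commute: "cov i j = cov j i"
  by (simp add: cov_def inner_commute)

text \<open>The covariance is an integral over the joint law at the times \<open>0\<close> and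
  \<open>t\<close>, which stationarity makes invariant under the shift by \<open>h\<close>.\<close>

lemma cov_shift: "cov (t + h) h = cov t 0"
proof -
  let ?J = "{0, t}"
  let ?g = "\<lambda>p. inner (\<Phi> (p t) - \<mu> P0) (\<Phi> (p 0) - \<mu> P0)"
  have g: "?g \<in> borel_measurable (\<Pi>\<^sub>M t\<in>?J. N)"
    by (intro measurable_inner_centred measurable_component_singleton) auto
  have m: "(\<lambda>\<omega>. \<lambda>t\<in>?J. X (t + h) \<omega>) \<in> measurable M (\<Pi>\<^sub>M t\<in>?J. N)" for h
    by (intro measurable_restrict measurable_X)
  have eq: "distr M (\<Pi>\<^sub>M t\<in>?J. N) (\<lambda>\<omega>. \<lambda>t\<in>?J. X (t + h) \<omega>) =
      distr M (\<Pi>\<^sub>M t\<in>?J. N) (\<lambda>\<omega>. \<lambda>t\<in>?J. X (t + 0) \<omega>)"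
    using stationary unfolding strictly_stationary_def by simp
  have "cov (t + h) (0 + h) = (\<integral>p. ?g p \<partial>distr M (\<Pi>\<^sub>M t\<in>?J. N) (\<lambda>\<omega>. \<lambda>t\<in>?J. X (t + h) \<omega>))" for h
    unfolding cov_def using integral_distr[OF m g, of h] by simp
  from this[of h] this[of 0] show ?thesis unfolding eq by simp
qed

lemma cov_le_dep_coeff: "cov (t + h) h \<le> dep_coeff M \<Phi> P0 X t"
  unfolding cov_shift by (simp add: cov_def dep_coeff_def)

text \<open>Cauchy-Schwarz as in \<open>integrable_centred\<close> would give only 4. Expanding the
  square gives the expectation of \<open>k(X, X)\<close> minus the squared norm of
  \<open>\<mu> P0\<close>, hence the constant 1.\<close>

lemma cov_self_le: "cov i i \<le> 1"
proof -
  have int: "integrable M (\<lambda>\<omega>. inner (\<mu> P0) (\<Phi> (X i \<omega>)))"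
    by (rule integrable_distr[OF measurable_X])
      (use integrable_inner_feature[OF prob_P0 sets_P0] marginal[of i] in simp)
  have "cov i i \<le> (\<integral>\<omega>. 1 - 2 * inner (\<mu> P0) (\<Phi> (X i \<omega>)) + inner (\<mu> P0) (\<mu> P0) \<partial>M)"
    unfolding cov_def
  proof (intro integral_mono integrable_centred)
    fix \<omega> assume "\<omega> \<in> space M"
    then show "inner (\<Phi> (X i \<omega>) - \<mu> P0) (\<Phi> (X i \<omega>) - \<mu> P0)
        \<le> 1 - 2 * inner (\<mu> P0) (\<Phi> (X i \<omega>)) + inner (\<mu> P0) (\<mu> P0)"
      using X_space[of \<omega> i] kernel_bound[of "X i \<omega>" "X i \<omega>"] by (simp add: inner_centred)
  qed (use int in simp)
  also have "\<dots> = 1 - 2 * (\<integral>\<omega>. inner (\<mu> P0) (\<Phi> (X i \<omega>)) \<partial>M) + inner (\<mu> P0) (\<mu> P0)"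
    using int by (simp add: prob_space)
  also have "(\<integral>\<omega>. inner (\<mu> P0) (\<Phi> (X i \<omega>)) \<partial>M) = inner (\<mu> P0) (\<mu> P0)"
    using integral_distr[OF measurable_X measurable_inner_feature, of i "\<mu> P0"]
      inner_mean_embedding[OF prob_P0 sets_P0, of "\<mu> P0"] marginal[of i] by simp
  finally show ?thesis using inner_ge_zero[of "\<mu> P0"] by linarith
qed

text \<open>The row splits at the diagonal. On either side the lags are distinct elements of
  \<open>{1..n}\<close>, so each side costs at most one full sum of coefficients.\<close>

lemma cov_row_sum_le:
  assumes i: "i \<in> {1..n}"
  shows "(\<Sum>j=1..n. cov i j) \<le> 1 + 2 * (\<Sum>t=1..n. dep_coeff M \<Phi> P0 X t)"
proof -
  let ?r = "dep_coeff M \<Phi> P0 X"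
  \<comment> \<open>The absolute value in the coefficients makes them nonnegative, so further lags
    may be added.\<close>
  have sub: "(\<Sum>t\<in>T. ?r t) \<le> (\<Sum>t=1..n. ?r t)" if "T \<subseteq> {1..n}" for T
    using that by (intro sum_mono2) (auto simp: dep_coeff_def)
  have "{1..n} = insert i ({1..<i} \<union> {i<..n})" using i by auto
  then have "(\<Sum>j=1..n. cov i j) = cov i i + ((\<Sum>j=1..<i. cov i j) + (\<Sum>j\<in>{i<..n}. cov i j))"
    by (simp, subst sum.union_disjoint) auto
  moreover have "(\<Sum>j=1..<i. cov i j) \<le> (\<Sum>t=1..n. ?r t)"
  proof -
    have "(\<Sum>j=1..<i. cov i j) \<le> (\<Sum>j=1..<i. ?r (i - j))"
      using cov_le_dep_coeff[of "i - j" j for j]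
      by (intro sum_mono) (metis atLeastLessThan_iff le_add_diff_inverse2
        less_imp_le_nat)
    also have "\<dots> = (\<Sum>t\<in>(\<lambda>j. i - j) ` {1..<i}. ?r t)"
      by (subst sum.reindex) (auto simp: inj_on_def)
    also have "\<dots> \<le> (\<Sum>t=1..n. ?r t)" using i by (intro sub) auto
    finally show ?thesis .
  qed
  moreover have "(\<Sum>j\<in>{i<..n}. cov i j) \<le> (\<Sum>t=1..n. ?r t)"
  proof -
    \<comment> \<open>Here \<open>j\<close> is the later index, so symmetry is applied first:
      \<open>cov i j\<close> equals \<open>cov ((j - i) + i) i\<close>.\<close>
    have "(\<Sum>j\<in>{i<..n}. cov i j) \<le> (\<Sum>j\<in>{i<..n}. ?r (j - i))"
      using cov_le_dep_coeff[of "j - i" i for j] cov_commute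
      by (intro sum_mono) (metis greaterThanAtMost_iff le_add_diff_inverse2 less_imp_le_nat)
    also have "\<dots> = (\<Sum>t\<in>(\<lambda>j. j - i) ` {i<..n}. ?r t)"
      by (subst sum.reindex) (auto simp: inj_on_def)
    also have "\<dots> \<le> (\<Sum>t=1..n. ?r t)" using i by (intro sub) auto
    finally show ?thesis .
  qed
  ultimately show ?thesis using cov_self_le[of i] by simp
qed

section \<open>Second moment of the MMD between the empirical measure and the marginal\<close>

text \<open>Since \<open>n \<ge> 1\<close>, \<open>\<mu> P0\<close> is the average of
  \<open>n\<close> copies of itself, so the difference of embeddings is an average of centred
  features.\<close>

lemma mmd_empirical_squared:
  assumes \<omega>: "\<omega> \<in> space M" and n: "n \<ge> 1"
  shows "(mmd \<Phi> (empirical_measure N n (\<lambda>i. X i \<omega>)) P0)\<^sup>2 =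
    (\<Sum>i=1..n. \<Sum>j=1..n. inner (\<Phi> (X i \<omega>) - \<mu> P0) (\<Phi> (X j \<omega>) - \<mu> P0)) / (real n)\<^sup>2"
proof -
  have "\<mu> (empirical_measure N n (\<lambda>i. X i \<omega>)) - \<mu> P0 =
      (1 / real n) *\<^sub>R (\<Sum>i=1..n. \<Phi> (X i \<omega>) - \<mu> P0)"
    using n X_space[OF \<omega>]
    by (simp add: mean_embedding_empirical sum_subtractf scaleR_diff_right sum_constant_scaleR)
  then show ?thesis
    unfolding mmd_def
    by (simp add: power_divide power2_norm_eq_inner[of "sum _ _"] inner_sum_left
        inner_sum_right[of "\<Phi> _ - _"])
qed

lemma
  assumes n: "n \<ge> 1"
  shows integrable_mmd_empirical:
      "integrable M (\<lambda>\<omega>. mmd \<Phi> (empirical_measure N n (\<lambda>i. X i \<omega>)) P0)"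
    and expectation_mmd_empirical_le:
      "expectation (\<lambda>\<omega>. mmd \<Phi> (empirical_measure N n (\<lambda>i. X i \<omega>)) P0)
        \<le> sqrt ((1 + 2 * (\<Sum>t=1..n. dep_coeff M \<Phi> P0 X t)) / real n)"
proof -
  let ?D = "\<lambda>\<omega>. mmd \<Phi> (empirical_measure N n (\<lambda>i. X i \<omega>)) P0"
  let ?S = "\<lambda>\<omega>.
    (\<Sum>i=1..n. \<Sum>j=1..n. inner (\<Phi> (X i \<omega>) - \<mu> P0) (\<Phi> (X j \<omega>) - \<mu> P0)) / (real n)\<^sup>2"
  have S: "integrable M ?S" using integrable_centred by simp
  have D2: "integrable M (\<lambda>\<omega>. (?D \<omega>)\<^sup>2)"
    using S mmd_empirical_squared[OF _ n] by (subst Bochner_Integration.integrable_cong) auto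
  \<comment> \<open>Measurability is known first for the square, a finite sum of scalar terms; the
    nonnegative distance is recovered as its square root.\<close>
  have "(\<lambda>\<omega>. sqrt ((?D \<omega>)\<^sup>2)) \<in> borel_measurable M"
    using borel_measurable_integrable[OF D2] by measurable
  then have meas: "?D \<in> borel_measurable M" by (simp add: mmd_def)
  show D: "integrable M ?D"
    using meas D2 by (rule square_integrable_imp_integrable)
  \<comment> \<open>Jensen for the square, in the form that the variance is nonnegative.\<close>
  have "(expectation ?D)\<^sup>2 \<le> expectation (\<lambda>\<omega>. (?D \<omega>)\<^sup>2)"
    using variance_eq[OF D D2] variance_positive[of ?D] by simp
  also have "\<dots> = expectation ?S"
    using mmd_empirical_squared[OF _ n] by (intro Bochner_Integration.integral_cong) auto
  also have "\<dots> = (\<Sum>i=1..n. \<Sum>j=1..n. cov i j) / (real n)\<^sup>2"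
    using integrable_centred by (simp add: cov_def)
  also have "\<dots> \<le> (\<Sum>i=1..n. 1 + 2 * (\<Sum>t=1..n. dep_coeff M \<Phi> P0 X t)) / (real n)\<^sup>2"
    by (intro divide_right_mono sum_mono cov_row_sum_le) auto
  \<comment> \<open>All \<open>n\<close> rows have the same bound, so one factor \<open>n\<close> of
    the denominator cancels.\<close>
  also have "\<dots> = (1 + 2 * (\<Sum>t=1..n. dep_coeff M \<Phi> P0 X t)) / real n"
    using n by (simp add: power2_eq_square)
  finally show "expectation ?D \<le> sqrt ((1 + 2 * (\<Sum>t=1..n. dep_coeff M \<Phi> P0 X t)) / real n)"
    by (rule real_le_rsqrt)
qed

end

section \<open>The oracle inequality for the estimator\<close>

theorem theorem3p1:
  fixes M :: "'w measure" and N :: "'a measure"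
    and X :: "nat \<Rightarrow> 'w \<Rightarrow> 'a" and P0 :: "'a measure"
    and \<Theta> :: "'t set" and P :: "'t \<Rightarrow> 'a measure"
    and k :: "'a \<Rightarrow> 'a \<Rightarrow> real"
    and evl :: "'h::{real_inner,complete_space} \<Rightarrow> 'a \<Rightarrow> real" and \<Phi> :: "'a \<Rightarrow> 'h"
    and n :: nat and \<theta>hat :: "'w \<Rightarrow> 't"
  assumes "prob_space M"
    and "strictly_stationary M N X"
    and "\<And>t. distr M N (X t) = P0"
    and "\<And>\<theta>. \<theta> \<in> \<Theta> \<Longrightarrow> P \<theta> \<in> prob_measures_on N"
    and "psd_kernel N k"
    and "\<And>x y. x \<in> space N \<Longrightarrow> y \<in> space N \<Longrightarrow> \<bar>k x y\<bar> \<le> 1"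
    and "is_rkhs (space N) k evl \<Phi>"
    and "characteristic_kernel N \<Phi>"
    and "n \<ge> 1"
    and "mmd_estimator M N \<Phi> \<Theta> P X n \<theta>hat"
    and "(\<lambda>\<omega>. mmd \<Phi> (P (\<theta>hat \<omega>)) P0) \<in> borel_measurable M"
  shows "prob_space.expectation M (\<lambda>\<omega>. mmd \<Phi> (P (\<theta>hat \<omega>)) P0)
           \<le> (INF \<theta>\<in>\<Theta>. mmd \<Phi> (P \<theta>) P0)
              + 2 * sqrt ((1 + 2 * (\<Sum>t=1..n. dep_coeff M \<Phi> P0 X t)) / real n)"
proof -
  interpret stationary_features N k evl \<Phi> M X P0
    using assms(1,2,3,5,6,7)
    by (simp add: stationary_features_def bounded_rkhs_def stationary_features_axioms_def)
  let ?E = "\<lambda>\<omega>. empirical_measure N n (\<lambda>i. X i \<omega>)"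
  let ?I = "INF \<theta>\<in>\<Theta>. mmd \<Phi> (P \<theta>) P0"
  have est: "\<theta>hat \<omega> \<in> \<Theta>"
    "mmd \<Phi> (P (\<theta>hat \<omega>)) (?E \<omega>) = (INF \<theta>\<in>\<Theta>. mmd \<Phi> (P \<theta>) (?E \<omega>))" if "\<omega> \<in> space M" for \<omega>
    using assms(10) that by (auto simp: mmd_estimator_def)
  \<comment> \<open>A probability space has a point, and the estimator there takes a value in
    \<open>\<Theta>\<close>; the infimum over an empty set would be an unspecified number.\<close>
  have ne: "\<Theta> \<noteq> {}" using est(1) not_empty by blast
  have triangle: "mmd \<Phi> A C \<le> mmd \<Phi> A B + mmd \<Phi> B C" for A B C :: "'a measure"
    unfolding mmd_def using norm_triangle_ineq[of "\<mu> A - \<mu> B" "\<mu> B - \<mu> C"] by simp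
  have mmd_commute: "mmd \<Phi> A B = mmd \<Phi> B A" for A B :: "'a measure"
    by (simp add: mmd_def norm_minus_commute)
  have pointwise: "mmd \<Phi> (P (\<theta>hat \<omega>)) P0 \<le> ?I + 2 * mmd \<Phi> (?E \<omega>) P0"
    if \<omega>: "\<omega> \<in> space M" for \<omega>
  proof -
    \<comment> \<open>The factor 2 comes from two passages through the empirical measure: from
      \<open>P0\<close> to it on the estimator's side, and back to \<open>P0\<close> on the side of
      \<open>\<theta>\<close>.\<close>
    have "mmd \<Phi> (P (\<theta>hat \<omega>)) P0 - 2 * mmd \<Phi> (?E \<omega>) P0 \<le> mmd \<Phi> (P \<theta>) P0" if "\<theta> \<in> \<Theta>" for \<theta>
    proof -
      have "bdd_below ((\<lambda>\<theta>. mmd \<Phi> (P \<theta>) (?E \<omega>)) ` \<Theta>)"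
        by (rule bdd_belowI2[of _ 0]) (simp add: mmd_def)
      then have "mmd \<Phi> (P (\<theta>hat \<omega>)) (?E \<omega>) \<le> mmd \<Phi> (P \<theta>) (?E \<omega>)"
        unfolding est(2)[OF \<omega>] using that by (rule cINF_lower)
      then show ?thesis
        using triangle[of "P (\<theta>hat \<omega>)" P0 "?E \<omega>"] triangle[of "P \<theta>" "?E \<omega>" P0]
          mmd_commute[of P0 "?E \<omega>"] by linarith
    qed
    then have "mmd \<Phi> (P (\<theta>hat \<omega>)) P0 - 2 * mmd \<Phi> (?E \<omega>) P0 \<le> ?I"
      using ne by (intro cINF_greatest)
    then show ?thesis by simp
  qed
  have D: "integrable M (\<lambda>\<omega>. ?I + 2 * mmd \<Phi> (?E \<omega>) P0)"
    using integrable_mmd_empirical[OF \<open>n \<ge> 1\<close>] by simp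
  \<comment> \<open>Monotonicity of the integral needs both sides integrable; the left side is
    nonnegative, measurable by hypothesis, and dominated by the right.\<close>
  have "integrable M (\<lambda>\<omega>. mmd \<Phi> (P (\<theta>hat \<omega>)) P0)"
    using D assms(11)
  proof (rule Bochner_Integration.integrable_bound)
    show "AE \<omega> in M. norm (mmd \<Phi> (P (\<theta>hat \<omega>)) P0) \<le> norm (?I + 2 * mmd \<Phi> (?E \<omega>) P0)"
    proof (rule AE_I2)
      fix \<omega> assume "\<omega> \<in> space M"
      moreover have "mmd \<Phi> (P (\<theta>hat \<omega>)) P0 \<ge> 0" by (simp add: mmd_def)
      ultimately show "norm (mmd \<Phi> (P (\<theta>hat \<omega>)) P0) \<le> norm (?I + 2 * mmd \<Phi> (?E \<omega>) P0)"
        using pointwise[of \<omega>] by simp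
    qed
  qed
  then have "expectation (\<lambda>\<omega>. mmd \<Phi> (P (\<theta>hat \<omega>)) P0)
      \<le> expectation (\<lambda>\<omega>. ?I + 2 * mmd \<Phi> (?E \<omega>) P0)"
    using D pointwise by (rule integral_mono)
  also have "\<dots> = ?I + 2 * expectation (\<lambda>\<omega>. mmd \<Phi> (?E \<omega>) P0)"
    using integrable_mmd_empirical[OF \<open>n \<ge> 1\<close>] by (simp add: prob_space)
  finally show ?thesis using expectation_mmd_empirical_le[OF \<open>n \<ge> 1\<close>] by simp
qed

end
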